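(* Let $L^\star\in\mathcal S_{[N]}^{++}$ and let $Z_1,\dots,Z_n$ be a sample of size $n$ (independent random subsets of $[N]$) from $\mathrm{DPP}(L^\star)$. Let $\hat L_n$ be the maximum likelihood estimator of $L^\star$, i.e. a global maximizer over $L\in\mathcal S_{[N]}^{++}$ of $$\hat\Phi_n(L)=\frac1n\sum_{i=1}^n\log P_L(Z_i).$$ Then $$\ell(\hat L_n,L^\star)=\min_{D\in\mathcal D}\Vert \hat L_n-DL^\star D\Vert_F$$ converges to zero almost surely (as $n\to\infty$).
   Context: $[N]=\{1,\dots,N\}$, and $\mathcal S_{[N]}^{++}$ is the set of real symmetric positive definite $N\times N$ matrices. For $L\in\mathcal S_{[N]}^{++}$, $\mathrm{DPP}(L)$ (the L-ensemble with kernel $L$) is the probability distribution on subsets of $[N]$ given by $$P_L(J)=\frac{\det(L_J)}{\det(L+I)},\qquad J\subseteq[N],$$ where $L_J=[L_{ij}]_{i,j\in J}$ and $\det(L_\emptyset)=1$. $\mathcal D$ is the set of all $N\times N$ diagonal matrices whose diagonal entries are each $1$ or $-1$, and $\Vert\cdot\Vert_F$ is the Frobenius norm. *)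

theory Defs
  imports "HOL-Probability.Probability"
begin

text \<open>The ground set \<open>[N]\<close> is the index type \<open>'n::finite\<close>, with \<open>N = CARD('n)\<close>.\<close>

definition sym_pos_def :: "(real^'n^'n) set" where
  "sym_pos_def = {L. transpose L = L \<and> (\<forall>x. x \<noteq> 0 \<longrightarrow> x \<bullet> (L *v x) > 0)}"

text \<open>The Leibniz sum defining \<^const>\<open>det\<close>, taken over an arbitrary index subset \<open>J\<close>
  because the order of a submatrix cannot be a type depending on \<open>J\<close>.\<close>

definition principal_minor :: "real^'n^'n \<Rightarrow> 'n set \<Rightarrow> real" where
  "principal_minor L J = (\<Sum>p | p permutes J. of_int (sign p) * (\<Prod>i\<in>J. L $ i $ p i))"

lemma principal_minor_UNIV: "principal_minor L UNIV = det L"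
  by (simp add: principal_minor_def det_def)

lemma principal_minor_empty: "principal_minor L {} = 1"
  by (simp add: principal_minor_def)

definition dpp_prob :: "real^'n^'n \<Rightarrow> 'n set \<Rightarrow> real" where
  "dpp_prob L J = principal_minor L J / det (L + mat 1)"

definition DPP :: "real^'n^'n \<Rightarrow> 'n set measure" where
  "DPP L = point_measure UNIV (\<lambda>J. ennreal (dpp_prob L J))"

text \<open>The sample \<open>Z\<^sub>1, \<dots>, Z\<^sub>n\<close> is \<open>z 0, \<dots>, z (n - 1)\<close>.\<close>

definition log_likelihood :: "nat \<Rightarrow> (nat \<Rightarrow> 'n set) \<Rightarrow> real^'n^'n \<Rightarrow> real" where
  "log_likelihood n z L = 1 / real n * (\<Sum>i<n. ln (dpp_prob L (z i)))"

text \<open>A global maximizer need not exist: if every \<open>z i\<close> is empty, the supremum is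
  approached only as \<open>L\<close> tends to zero, which is not positive definite.\<close>

definition is_MLE :: "nat \<Rightarrow> (nat \<Rightarrow> 'n set) \<Rightarrow> real^'n^'n \<Rightarrow> bool" where
  "is_MLE n z L \<longleftrightarrow> is_arg_max (log_likelihood n z) (\<lambda>K. K \<in> sym_pos_def) L"

definition sign_matrices :: "(real^'n^'n) set" where
  "sign_matrices = {D. (\<forall>i. D $ i $ i \<in> {1, -1}) \<and> (\<forall>i j. i \<noteq> j \<longrightarrow> D $ i $ j = 0)}"

definition frobenius_norm :: "real^'n^'n \<Rightarrow> real" where
  "frobenius_norm A = sqrt (\<Sum>i\<in>UNIV. \<Sum>j\<in>UNIV. (A $ i $ j)\<^sup>2)"

lemma frobenius_norm_eq_norm: "frobenius_norm A = norm A"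
  by (simp add: frobenius_norm_def norm_vec_def L2_set_def sum_nonneg)

definition dpp_loss :: "real^'n^'n \<Rightarrow> real^'n^'n \<Rightarrow> real" where
  "dpp_loss A B = Min ((\<lambda>D. frobenius_norm (A - D ** B ** D)) ` sign_matrices)"

text \<open>The set over which the minimum is taken is finite and nonempty.\<close>

lemma finite_sign_matrices: "finite (sign_matrices :: (real^'n^'n) set)"
proof (rule finite_subset)
  show "(sign_matrices :: (real^'n^'n) set) \<subseteq>
      range (\<lambda>S. \<chi> i j. if i = j then (if i \<in> S then 1 else -1) else 0)"
  proof
    fix D :: "real^'n^'n" assume "D \<in> sign_matrices"
    then have "D = (\<chi> i j. if i = j then (if i \<in> {i. D $ i $ i = 1} then 1 else -1) else 0)"
      by (auto simp: sign_matrices_def vec_eq_iff)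
    then show "D \<in> range (\<lambda>S. \<chi> i j. if i = j then (if i \<in> S then 1 else -1) else 0)"
      by blast
  qed
qed simp

lemma sign_matrices_nonempty: "sign_matrices \<noteq> {}"
proof -
  have "mat 1 \<in> sign_matrices"
    by (simp add: sign_matrices_def mat_def)
  then show ?thesis by blast
qed

end

(* Almost surely every empirical frequency converges to P_{L*}(J) > 0 (Hoeffding and
   Borel-Cantelli). Once all frequencies are bounded below by some delta > 0, any L whose likelihood
   is at least that of L* has all its probabilities bounded below, which confines L to a compact set
   of positive definite matrices; so a maximizer exists and every limit point l of the maximizers is
   positive definite. By Gibbs' inequality P_l = P_{L*}, that is, l and L* have the same principal
   minors, and symmetric matrices with the same nonzero principal minors are conjugate by a sign
   matrix. The last fact follows by induction on the size, using Schur complements. *)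

theory Submission
  imports Defs
begin

section \<open>Principal minors as determinants, and Schur complements\<close>

text \<open>Completing the submatrix by an identity block keeps the matrix type fixed, so that
  determinant rules such as \<open>det_mul\<close> apply to principal minors.\<close>

definition pad :: "real^'n^'n \<Rightarrow> 'n set \<Rightarrow> real^'n^'n" where
  "pad A J = (\<chi> i j. if i \<in> J \<and> j \<in> J then A $ i $ j else if i = j then 1 else 0)"

text \<open>Kept at full size: for a nonzero pivot \<open>A $ v $ v\<close>, the row and column of
  \<open>v\<close> become zero instead of being deleted.\<close>

definition schur_complement :: "real^'n^'n \<Rightarrow> 'n \<Rightarrow> real^'n^'n" where
  "schur_complement A v = (\<chi> i j. A $ i $ j - A $ i $ v * A $ v $ j / A $ v $ v)"

text \<open>The surviving permutations fix every index outside \<open>J\<close>, so there they pick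
  diagonal entries. This evaluates \<open>pad A J\<close> and both factors of the elimination
  below.\<close>

lemma det_eq_sum_permutes_subset:
  fixes A :: "real^'n^'n"
  assumes "\<And>p. p permutes UNIV \<Longrightarrow> \<not> p permutes J \<Longrightarrow> \<exists>i. A $ i $ p i = 0"
  shows "det A = (\<Sum>p | p permutes J. of_int (sign p) * ((\<Prod>i\<in>J. A $ i $ p i) * (\<Prod>i\<in>-J. A $ i $ i)))"
proof -
  have "det A = (\<Sum>p | p permutes J. of_int (sign p) * (\<Prod>i\<in>UNIV. A $ i $ p i))"
    unfolding det_def
  proof (rule sum.mono_neutral_right)
    show "{p. p permutes J} \<subseteq> {p. p permutes UNIV}"
      using permutes_subset by blast
    show "\<forall>p\<in>{p. p permutes UNIV} - {p. p permutes J}. of_int (sign p) * (\<Prod>i\<in>UNIV. A $ i $ p i) = 0"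
      using assms by fastforce
  qed (simp add: finite_permutations)
  also have "\<dots> = (\<Sum>p | p permutes J. of_int (sign p) * ((\<Prod>i\<in>J. A $ i $ p i) * (\<Prod>i\<in>-J. A $ i $ i)))"
  proof (intro sum.cong refl arg_cong2[where f="(*)"])
    fix p assume p: "p \<in> {p. p permutes J}"
    have "(\<Prod>i\<in>UNIV. A $ i $ p i) = (\<Prod>i\<in>J. A $ i $ p i) * (\<Prod>i\<in>-J. A $ i $ p i)"
      by (subst prod.union_disjoint[symmetric]) auto
    also have "(\<Prod>i\<in>-J. A $ i $ p i) = (\<Prod>i\<in>-J. A $ i $ i)"
      using p by (intro prod.cong) (auto simp: permutes_def)
    finally show "(\<Prod>i\<in>UNIV. A $ i $ p i) = (\<Prod>i\<in>J. A $ i $ p i) * (\<Prod>i\<in>-J. A $ i $ i)" .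
  qed
  finally show ?thesis .
qed

lemma not_permutes_moves:
  assumes "p permutes UNIV" "\<not> p permutes J"
  obtains i where "i \<notin> J" "p i \<noteq> i"
  using assms unfolding permutes_def by auto

lemma det_pad:
  fixes A :: "real^'n^'n"
  shows "det (pad A J) = principal_minor A J"
proof -
  have "\<exists>i. pad A J $ i $ p i = 0" if p: "p permutes UNIV" "\<not> p permutes J" for p
    by (rule not_permutes_moves[OF p], auto simp: pad_def)
  then have "det (pad A J) = (\<Sum>p | p permutes J. of_int (sign p) *
      ((\<Prod>i\<in>J. pad A J $ i $ p i) * (\<Prod>i\<in>-J. pad A J $ i $ i)))"
    by (rule det_eq_sum_permutes_subset)
  also have "\<dots> = principal_minor A J"
    unfolding principal_minor_def
  proof (intro sum.cong refl arg_cong2[where f="(*)"])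
    fix p assume "p \<in> {p. p permutes J}"
    then have "(\<Prod>i\<in>J. pad A J $ i $ p i) = (\<Prod>i\<in>J. A $ i $ p i)"
      by (intro prod.cong) (auto simp: pad_def permutes_in_image)
    moreover have "(\<Prod>i\<in>-J. pad A J $ i $ i) = 1"
      by (intro prod.neutral) (auto simp: pad_def)
    ultimately show "(\<Prod>i\<in>J. pad A J $ i $ p i) * (\<Prod>i\<in>-J. pad A J $ i $ i) = (\<Prod>i\<in>J. A $ i $ p i)"
      by simp
  qed
  finally show ?thesis .
qed

lemma principal_minor_singleton [simp]: "principal_minor A {i} = A $ i $ i"
  by (simp add: principal_minor_def)

text \<open>One step of Gaussian elimination at the pivot \<open>v\<close>, written as a
  factorisation \<open>E ** S\<close> of the padded matrix. \<open>S\<close> has the Schur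
  complement on \<open>J\<close> and its column \<open>v\<close> cleared below and above the pivot;
  \<open>E\<close> adds the multiples of row \<open>v\<close> back and has determinant 1.\<close>

lemma principal_minor_schur_complement:
  fixes A :: "real^'n^'n"
  assumes v: "v \<notin> J" and nz: "A $ v $ v \<noteq> 0"
  shows "principal_minor A (insert v J) = A $ v $ v * principal_minor (schur_complement A v) J"
proof -
  define E :: "real^'n^'n" where
    "E = (\<chi> i j. if i = j then 1 else if i \<in> J \<and> j = v then A $ i $ v / A $ v $ v else 0)"
  define S :: "real^'n^'n" where
    "S = (\<chi> i j. if i \<in> J then (if j \<in> J then schur_complement A v $ i $ j else 0)
                 else if i = v then (if j \<in> insert v J then A $ v $ j else 0)
                 else if i = j then 1 else 0)"
  have "pad A (insert v J) = E ** S"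
  proof (intro vec_eq_iff[THEN iffD2] allI)
    fix i j
    have "(E ** S) $ i $ j = (\<Sum>k\<in>UNIV. E $ i $ k * S $ k $ j)"
      by (simp add: matrix_matrix_mult_def)
    also have "\<dots> = (\<Sum>k\<in>{i, v}. E $ i $ k * S $ k $ j)"
      by (rule sum.mono_neutral_right) (auto simp: E_def)
    also have "\<dots> = pad A (insert v J) $ i $ j"
      using v nz by (cases "i = v") (auto simp: E_def S_def pad_def schur_complement_def)
    finally show "pad A (insert v J) $ i $ j = (E ** S) $ i $ j" by simp
  qed
  moreover have "det E = 1"
  proof -
    \<comment> \<open>Off the diagonal, \<open>E\<close> is nonzero only in column \<open>v\<close>,
      at rows of \<open>J\<close>. If \<open>p\<close> fixes \<open>v\<close>, no other index is
      sent to that column; if \<open>p\<close> moves \<open>v\<close>, row \<open>v\<close>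
      contributes a zero.\<close>
    have "\<exists>i. E $ i $ p i = 0" if p: "p permutes UNIV" "\<not> p permutes {}" for p
    proof (cases "p v = v")
      case True
      obtain i where "p i \<noteq> i" using p by (meson not_permutes_moves)
      moreover from this have "p i \<noteq> v" using True p by (metis permutes_inj injD)
      ultimately show ?thesis by (intro exI[of _ i]) (auto simp: E_def)
    next
      case False
      then show ?thesis using v by (intro exI[of _ v]) (auto simp: E_def)
    qed
    then have "det E = (\<Sum>p | p permutes {}. of_int (sign p) *
        ((\<Prod>i\<in>{}. E $ i $ p i) * (\<Prod>i\<in>-{}. E $ i $ i)))"
      by (rule det_eq_sum_permutes_subset)
    then have "det E = (\<Prod>i\<in>UNIV. E $ i $ i)"
      by simp
    then show ?thesis by (simp add: E_def)
  qed
  moreover have "det S = A $ v $ v * principal_minor (schur_complement A v) J"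
  proof -
    have "\<exists>i. S $ i $ p i = 0" if p: "p permutes UNIV" "\<not> p permutes J" for p
    proof -
      obtain i where i: "i \<notin> J" "p i \<noteq> i" using p by (rule not_permutes_moves)
      show ?thesis
      proof (cases "i = v")
        \<comment> \<open>If \<open>v\<close> is moved, the index \<open>k\<close> sent to
          \<open>v\<close> differs from \<open>v\<close> and meets the cleared column
          \<open>v\<close> of \<open>S\<close>.\<close>
        case True
        obtain k where k: "p k = v" using p by (metis permutes_surj surjD)
        then have "k \<noteq> v" using i True by auto
        then show ?thesis using k v by (intro exI[of _ k]) (auto simp: S_def)
      next
        case False
        then show ?thesis using i by (intro exI[of _ i]) (auto simp: S_def)
      qed
    qed
    then have "det S = (\<Sum>p | p permutes J. of_int (sign p) * ((\<Prod>i\<in>J. S $ i $ p i) * (\<Prod>i\<in>-J. S $ i $ i)))"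
      by (rule det_eq_sum_permutes_subset)
    also have "(\<Prod>i\<in>-J. S $ i $ i) = A $ v $ v"
    proof -
      have "(\<Prod>i\<in>-J. S $ i $ i) = (\<Prod>i\<in>{v}. S $ i $ i)"
        using v by (intro prod.mono_neutral_right) (auto simp: S_def)
      then show ?thesis using v by (simp add: S_def)
    qed
    also have "(\<Sum>p | p permutes J. of_int (sign p) * ((\<Prod>i\<in>J. S $ i $ p i) * A $ v $ v))
        = (\<Sum>p | p permutes J. A $ v $ v * (of_int (sign p) * (\<Prod>i\<in>J. schur_complement A v $ i $ p i)))"
    proof (intro sum.cong refl)
      fix p assume "p \<in> {p. p permutes J}"
      then have "(\<Prod>i\<in>J. S $ i $ p i) = (\<Prod>i\<in>J. schur_complement A v $ i $ p i)"
        by (intro prod.cong) (auto simp: S_def permutes_in_image)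
      then show "of_int (sign p) * ((\<Prod>i\<in>J. S $ i $ p i) * A $ v $ v)
          = A $ v $ v * (of_int (sign p) * (\<Prod>i\<in>J. schur_complement A v $ i $ p i))"
        by simp
    qed
    finally show ?thesis
      by (simp add: principal_minor_def sum_distrib_left)
  qed
  ultimately show ?thesis
    by (metis det_pad det_mul mult_1)
qed

section \<open>Symmetric matrices with equal principal minors\<close>

text \<open>Here \<open>C\<close> is the old block, \<open>a\<close> the new column,
  \<open>u\<close> the signs by which the column still differs, and \<open>e\<close> the signs
  relating the Schur complements. The aim is to absorb \<open>u\<close> into a sign change
  \<open>f\<close> that leaves \<open>C\<close> alone, up to one global sign \<open>s\<close>. If
  \<open>u\<close> is constant where \<open>a\<close> is nonzero, \<open>f = 1\<close> does it;
  otherwise \<open>e\<close> itself serves as \<open>f\<close>.\<close>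

lemma combine_signs:
  fixes a d e u :: "'a \<Rightarrow> real" and C :: "'a \<Rightarrow> 'a \<Rightarrow> real"
  assumes u: "\<And>i. u i \<in> {1, -1}" and e: "\<And>i. e i \<in> {1, -1}"
    and eq: "\<And>i j. i \<in> V \<Longrightarrow> j \<in> V \<Longrightarrow>
      C i j - u i * u j * (a i * a j / c) = e i * e j * (C i j - a i * a j / c)"
    and c: "c \<noteq> 0"
  obtains f s where "\<And>i. f i \<in> {1, -1}" "s \<in> {1, - 1 :: real}"
    "\<And>i j. i \<in> V \<Longrightarrow> j \<in> V \<Longrightarrow> f i * f j * C i j = C i j"
    "\<And>i. i \<in> V \<Longrightarrow> s * f i * a i = u i * a i"
proof (cases "\<exists>s\<in>{1, -1}. \<forall>i\<in>V. a i \<noteq> 0 \<longrightarrow> u i = s")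
  case True
  then obtain s where s: "s \<in> {1, -1}" "\<And>i. i \<in> V \<Longrightarrow> a i \<noteq> 0 \<Longrightarrow> u i = s" by blast
  show ?thesis
    by (rule that[of "\<lambda>_. 1" s]) (use s in force)+
next
  case False
  then obtain p where p: "p \<in> V" "a p \<noteq> 0" "u p = 1" using u by fastforce
  from False obtain q where q: "q \<in> V" "a q \<noteq> 0" "u q = -1" using u by fastforce
  \<comment> \<open>Where \<open>a\<close> is nonzero, \<open>u\<close> is a function of
    \<open>e\<close>. Since both signs of \<open>u\<close> occur there, at \<open>p\<close> and
    \<open>q\<close>, it follows that \<open>u\<close> is \<open>e\<close> up to the global sign
    \<open>e p\<close>.\<close>
  have same: "u i = u j" if "i \<in> V" "j \<in> V" "a i \<noteq> 0" "a j \<noteq> 0" "e i = e j" for i j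
  proof -
    have "e i * e j = 1" using e[of i] that by auto
    with eq[of i j] that c have "u i * u j = 1" by auto
    then show ?thesis using u[of i] u[of j] by auto
  qed
  have eu: "e p * e i = u i" if "i \<in> V" "a i \<noteq> 0" for i
    using same[of p q] same[of i p] same[of i q] that p q e[of i] e[of p] e[of q] by fastforce
  show ?thesis
  proof (rule that[of e "e p"])
    fix i j assume ij: "i \<in> V" "j \<in> V"
    show "e i * e j * C i j = C i j"
    proof (rule ccontr)
      \<comment> \<open>With opposite signs \<open>e i\<close> and \<open>e j\<close>, the
        hypothesis expresses \<open>C i j\<close> through \<open>a i * a j\<close>. A nonzero
        \<open>C i j\<close> then makes \<open>a i\<close> and \<open>a j\<close> nonzero, so
        \<open>u i * u j = -1\<close>, which annihilates the right-hand side.\<close>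
      assume neq: "e i * e j * C i j \<noteq> C i j"
      then have ee: "e i * e j = -1" using e[of i] e[of j] by auto
      then have *: "2 * C i j = (1 + u i * u j) * (a i * a j / c)"
        using eq[OF ij] by (simp add: algebra_simps add_divide_distrib)
      have "C i j \<noteq> 0" using neq by auto
      then have "a i \<noteq> 0" "a j \<noteq> 0" using * by auto
      then have "u i * u j = (e p * e p) * (e i * e j)"
        using eu[OF ij(1)] eu[OF ij(2)] by (metis mult.assoc mult.left_commute)
      also have "\<dots> = -1" using ee e[of p] by auto
      finally show False using * \<open>C i j \<noteq> 0\<close> by simp
    qed
  qed (use e eu in auto)
qed

text \<open>The induction applies the hypothesis both to \<open>A\<close> restricted to \<open>V\<close> and to the Schur
  complement of \<open>A\<close> at the new index; the two sign vectors obtained are then reconciled.\<close>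

lemma sign_similar_if_principal_minors_eq:
  fixes A B :: "real^'n^'n"
  assumes "finite V" "transpose A = A" "transpose B = B"
    and "\<And>J. J \<subseteq> V \<Longrightarrow> principal_minor A J = principal_minor B J"
    and "\<And>J. J \<subseteq> V \<Longrightarrow> principal_minor A J \<noteq> 0"
  obtains d where "\<And>i. d i \<in> {1, - 1 :: real}"
    "\<And>i j. i \<in> V \<Longrightarrow> j \<in> V \<Longrightarrow> B $ i $ j = d i * d j * A $ i $ j"
proof -
  have "\<exists>d. (\<forall>i. d i \<in> {1, - 1 :: real}) \<and> (\<forall>i\<in>V. \<forall>j\<in>V. B $ i $ j = d i * d j * A $ i $ j)"
    using assms
  proof (induction V arbitrary: A B rule: finite_induct)
    case empty
    show ?case by (intro exI[of _ "\<lambda>_. 1"]) auto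
  next
    case (insert v V)
    have symA: "A $ i $ j = A $ j $ i" for i j
      using insert.prems(1) by (metis transpose_def vec_lambda_beta)
    have symB: "B $ i $ j = B $ j $ i" for i j
      using insert.prems(2) by (metis transpose_def vec_lambda_beta)
    define c where "c = A $ v $ v"
    have c: "c \<noteq> 0" "B $ v $ v = c"
      using insert.prems(3,4)[of "{v}"] by (auto simp: c_def)
    define A' B' where "A' = schur_complement A v" and "B' = schur_complement B v"
    have A': "principal_minor A (insert v J) = c * principal_minor A' J"
      and B': "principal_minor B (insert v J) = c * principal_minor B' J" if "J \<subseteq> V" for J
      using that insert.hyps c principal_minor_schur_complement[of v J A]
        principal_minor_schur_complement[of v J B] by (auto simp: A'_def B'_def c_def)
    have "\<exists>d. (\<forall>i. d i \<in> {1, - 1 :: real}) \<and> (\<forall>i\<in>V. \<forall>j\<in>V. B $ i $ j = d i * d j * A $ i $ j)"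
      by (rule insert.IH) (use insert.prems(1,2) insert.prems(3,4)[OF subset_insertI2] in auto)
    then obtain d where d: "\<And>i. d i \<in> {1, - 1 :: real}"
      "\<And>i j. i \<in> V \<Longrightarrow> j \<in> V \<Longrightarrow> B $ i $ j = d i * d j * A $ i $ j" by blast
    have "\<exists>d. (\<forall>i. d i \<in> {1, - 1 :: real}) \<and> (\<forall>i\<in>V. \<forall>j\<in>V. B' $ i $ j = d i * d j * A' $ i $ j)"
    proof (rule insert.IH)
      show "transpose A' = A'" "transpose B' = B'"
        using symA symB by (auto simp: A'_def B'_def schur_complement_def transpose_def vec_eq_iff)
      fix J assume J: "J \<subseteq> V"
      then have J': "insert v J \<subseteq> insert v V" by auto
      show "principal_minor A' J = principal_minor B' J" "principal_minor A' J \<noteq> 0"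
        using insert.prems(3,4)[OF J'] A'[OF J] B'[OF J] c by auto
    qed
    then obtain d' where d': "\<And>i. d' i \<in> {1, - 1 :: real}"
      "\<And>i j. i \<in> V \<Longrightarrow> j \<in> V \<Longrightarrow> B' $ i $ j = d' i * d' j * A' $ i $ j" by blast
    define a b where "a i = A $ i $ v" and "b i = B $ i $ v" for i
    have schur: "B $ i $ j - b i * b j / c = d' i * d' j * (A $ i $ j - a i * a j / c)"
      if "i \<in> V" "j \<in> V" for i j
      using d'(2)[OF that] c symA[of v j] symB[of v j]
      by (simp add: A'_def B'_def schur_complement_def a_def b_def c_def)
    have sq: "x * x = 1" if "x \<in> {1, - 1 :: real}" for x using that by auto
    \<comment> \<open>The case \<open>i = j\<close> of \<open>schur\<close>: all signs are squared
      and the diagonals of \<open>A\<close> and \<open>B\<close> agree on \<open>V\<close>, leaving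
      equality of the squares of \<open>a i\<close> and \<open>b i\<close>.\<close>
    have ab: "b i = a i \<or> b i = - a i" if "i \<in> V" for i
    proof -
      have "b i * b i / c = a i * a i / c"
        using schur[OF that that] d(2)[OF that that] sq[OF d(1)[of i]] sq[OF d'(1)[of i]] by simp
      then have "(b i)\<^sup>2 = (a i)\<^sup>2" using c by (simp add: power2_eq_square)
      then show ?thesis by (simp add: power2_eq_iff)
    qed
    define t where "t i = (if b i = a i then 1 else - 1 :: real)" for i
    have t: "t i \<in> {1, -1}" "i \<in> V \<Longrightarrow> b i = t i * a i" for i
      using ab[of i] by (auto simp: t_def)
    have mult: "x * y \<in> {1, -1}" if "x \<in> {1, - 1 :: real}" "y \<in> {1, -1}" for x y
      using that by auto
    \<comment> \<open>Multiplying \<open>schur\<close> by \<open>d i * d j\<close> turns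
      \<open>B\<close> on \<open>V\<close> back into \<open>A\<close> and \<open>b i\<close> into
      \<open>d i * t i * a i\<close>, which is the hypothesis of
      \<open>combine_signs\<close>.\<close>
    have eq: "A $ i $ j - (d i * t i) * (d j * t j) * (a i * a j / c)
        = (d i * d' i) * (d j * d' j) * (A $ i $ j - a i * a j / c)"
      if ij: "i \<in> V" "j \<in> V" for i j
    proof -
      have "d i * d j * (B $ i $ j - b i * b j / c)
          = (d i * d i) * (d j * d j) * A $ i $ j - (d i * t i) * (d j * t j) * (a i * a j / c)"
        using d(2)[OF ij] t(2)[OF ij(1)] t(2)[OF ij(2)] by (simp add: algebra_simps)
      also have "\<dots> = A $ i $ j - (d i * t i) * (d j * t j) * (a i * a j / c)"
        using sq[OF d(1)] by simp
      finally show ?thesis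
        using schur[OF ij] by (simp add: mult_ac)
    qed
    obtain f s where f: "\<And>i. f i \<in> {1, - 1 :: real}" and s: "s \<in> {1, - 1 :: real}"
      and fA: "\<And>i j. i \<in> V \<Longrightarrow> j \<in> V \<Longrightarrow> f i * f j * A $ i $ j = A $ i $ j"
      and fa: "\<And>i. i \<in> V \<Longrightarrow> s * f i * a i = d i * t i * a i"
      using combine_signs[where u = "\<lambda>i. d i * t i" and e = "\<lambda>i. d i * d' i" and V = V
          and C = "\<lambda>i j. A $ i $ j" and a = a and c = c] mult[OF d(1) t(1)] mult[OF d(1) d'(1)] eq c(1)
      by metis
    \<comment> \<open>On \<open>V\<close> the signs \<open>d\<close> are corrected by
      \<open>f\<close>, which does not change the block; the global sign \<open>s\<close> goes to
      the new index, where its square disappears on the diagonal.\<close>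
    define g where "g i = (if i = v then s else d i * f i)" for i
    have bv: "b i = s * (d i * f i) * a i" if "i \<in> V" for i
    proof -
      have "s * (d i * f i) * a i = d i * (s * f i * a i)" by (simp add: mult_ac)
      also have "\<dots> = (d i * d i) * (t i * a i)" unfolding fa[OF that] by (simp add: mult_ac)
      finally show ?thesis
        unfolding sq[OF d(1)[of i]] t(2)[OF that] by (simp only: mult_1_left)
    qed
    have "B $ i $ j = g i * g j * A $ i $ j" if ij: "i \<in> insert v V" "j \<in> insert v V" for i j
    proof -
      consider "i = v" "j = v" | "i = v" "j \<in> V" "j \<noteq> v" | "i \<in> V" "i \<noteq> v" "j = v"
        | "i \<in> V" "j \<in> V" "i \<noteq> v" "j \<noteq> v"
        using ij by blast
      then show ?thesis
      proof cases
        case 1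
        then show ?thesis using sq[OF s] c by (simp add: g_def c_def)
      next
        case 2
        then show ?thesis using bv[of j] symA[of v j] symB[of v j]
          by (simp add: g_def a_def b_def)
      next
        case 3
        then show ?thesis using bv[of i] by (simp add: g_def a_def b_def mult_ac)
      next
        case 4
        then have "g i * g j * A $ i $ j = d i * d j * (f i * f j * A $ i $ j)"
          by (simp add: g_def mult_ac)
        also have "\<dots> = B $ i $ j" using fA d(2) 4 by simp
        finally show ?thesis by simp
      qed
    qed
    moreover have "g i \<in> {1, -1}" for i
      using s mult[OF d(1)[of i] f[of i]] by (simp add: g_def)
    ultimately show ?case by blast
  qed
  then show ?thesis using that by blast
qed

section \<open>Normalising constant and positivity of the probabilities\<close>

text \<open>Each Leibniz product for \<open>L + mat 1\<close> is expanded over the set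
  \<open>J\<close> of rows whose factor comes from \<open>L\<close>. The remaining rows take a
  factor of the identity, which forces the permutation to fix them.\<close>

lemma sum_principal_minor:
  fixes L :: "real^'n^'n"
  shows "(\<Sum>J\<in>UNIV. principal_minor L J) = det (L + mat 1)"
proof -
  have "det (L + mat 1) = (\<Sum>p | p permutes UNIV. of_int (sign p) *
      (\<Prod>i\<in>UNIV. L $ i $ p i + (if i = p i then 1 else 0)))"
    by (simp add: det_def mat_def)
  also have "\<dots> = (\<Sum>p | p permutes UNIV. \<Sum>J\<in>UNIV. of_int (sign p) *
      ((\<Prod>i\<in>J. L $ i $ p i) * (\<Prod>i\<in>-J. if i = p i then 1 else 0)))"
    by (simp add: prod_add sum_distrib_left Compl_eq_Diff_UNIV)
  also have "\<dots> = (\<Sum>J\<in>UNIV. \<Sum>p | p permutes UNIV. of_int (sign p) *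
      ((\<Prod>i\<in>J. L $ i $ p i) * (\<Prod>i\<in>-J. if i = p i then 1 else 0)))"
    by (rule sum.swap)
  also have "\<dots> = (\<Sum>J\<in>UNIV. principal_minor L J)"
  proof (intro sum.cong refl)
    fix J :: "'n set"
    have "(\<Sum>p | p permutes UNIV. of_int (sign p) *
          ((\<Prod>i\<in>J. L $ i $ p i) * (\<Prod>i\<in>-J. if i = p i then 1 else 0)))
        = (\<Sum>p | p permutes J. of_int (sign p) *
          ((\<Prod>i\<in>J. L $ i $ p i) * (\<Prod>i\<in>-J. if i = p i then 1 else 0)))"
    proof (rule sum.mono_neutral_right)
      show "{p. p permutes J} \<subseteq> {p. p permutes UNIV}"
        using permutes_subset by blast
      show "\<forall>p\<in>{p. p permutes UNIV} - {p. p permutes J}. of_int (sign p) *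
          ((\<Prod>i\<in>J. L $ i $ p i) * (\<Prod>i\<in>-J. if i = p i then 1 else 0)) = 0"
      proof
        fix p assume "p \<in> {p. p permutes UNIV} - {p. p permutes J}"
        then obtain i where "i \<notin> J" "p i \<noteq> i"
          using not_permutes_moves[of p J] by auto
        then have "(\<Prod>i\<in>-J. if i = p i then 1 else 0 :: real) = 0"
          by (intro prod_zero) (auto intro!: bexI[of _ i])
        then show "of_int (sign p) *
            ((\<Prod>i\<in>J. L $ i $ p i) * (\<Prod>i\<in>-J. if i = p i then 1 else 0)) = 0"
          by simp
      qed
    qed (simp add: finite_permutations)
    also have "\<dots> = principal_minor L J"
      unfolding principal_minor_def
    proof (intro sum.cong refl)
      fix p assume "p \<in> {p. p permutes J}"
      then have "(\<Prod>i\<in>-J. if i = p i then 1 else 0 :: real) = 1"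
        by (intro prod.neutral) (auto simp: permutes_def)
      then show "of_int (sign p) * ((\<Prod>i\<in>J. L $ i $ p i) * (\<Prod>i\<in>-J. if i = p i then 1 else 0))
          = of_int (sign p) * (\<Prod>i\<in>J. L $ i $ p i)" by simp
    qed
    finally show "(\<Sum>p | p permutes UNIV. of_int (sign p) *
          ((\<Prod>i\<in>J. L $ i $ p i) * (\<Prod>i\<in>-J. if i = p i then 1 else 0))) = principal_minor L J" .
  qed
  finally show ?thesis by simp
qed

lemma sym_pos_def_det_nonzero:
  fixes L :: "real^'n^'n"
  assumes "L \<in> sym_pos_def"
  shows "det L \<noteq> 0"
proof -
  have "x = 0" if "L *v x = 0" for x
    using assms that unfolding sym_pos_def_def by (metis (mono_tags, lifting) inner_zero_right less_irrefl mem_Collect_eq)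
  then show ?thesis
    by (metis invertible_det_nz invertible_left_inverse matrix_left_invertible_ker)
qed

lemma mat_1_sym_pos_def: "mat 1 \<in> sym_pos_def"
  by (simp add: sym_pos_def_def transpose_mat)

lemma sym_pos_def_convex_combination:
  fixes K L :: "real^'n^'n"
  assumes K: "K \<in> sym_pos_def" and L: "L \<in> sym_pos_def" and "0 \<le> s" "0 \<le> t" "0 < s + t"
  shows "s *\<^sub>R K + t *\<^sub>R L \<in> sym_pos_def"
proof -
  have "0 < s * (x \<bullet> (K *v x)) + t * (x \<bullet> (L *v x))" if "x \<noteq> 0" for x
  proof -
    have "0 < x \<bullet> (K *v x)" "0 < x \<bullet> (L *v x)"
      using K L that by (auto simp: sym_pos_def_def)
    then show ?thesis
      using assms(3-5) by (cases "s = 0") (auto intro: add_pos_nonneg)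
  qed
  moreover have "transpose (s *\<^sub>R K + t *\<^sub>R L) = s *\<^sub>R K + t *\<^sub>R L"
    using K L by (auto simp: sym_pos_def_def transpose_def vec_eq_iff)
  ultimately show ?thesis
    by (simp add: sym_pos_def_def matrix_vector_mult_add_rdistrib
        scaleR_matrix_vector_assoc[symmetric] inner_add_right)
qed

lemma continuous_on_principal_minor [continuous_intros]:
  fixes f :: "'a::topological_space \<Rightarrow> real^'n^'n"
  assumes "continuous_on S f"
  shows "continuous_on S (\<lambda>x. principal_minor (f x) J)"
  unfolding principal_minor_def by (intro continuous_intros assms)

text \<open>The segment from the identity to \<open>L\<close> stays positive definite, so the
  determinant never vanishes along it and keeps the sign it has at the identity.\<close>

lemma sym_pos_def_det_pos:
  fixes L :: "real^'n^'n"
  assumes L: "L \<in> sym_pos_def"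
  shows "det L > 0"
proof (rule ccontr)
  let ?f = "\<lambda>t::real. det ((1 - t) *\<^sub>R mat 1 + t *\<^sub>R L)"
  assume "\<not> det L > 0"
  moreover have "continuous_on {0..1} ?f"
    unfolding principal_minor_UNIV[symmetric] by (intro continuous_intros)
  ultimately obtain t where "0 \<le> t" "t \<le> 1" "?f t = 0"
    using IVT2'[of ?f 1 0 0] by auto
  then show False
    using sym_pos_def_det_nonzero[OF sym_pos_def_convex_combination[OF mat_1_sym_pos_def L]]
    by (metis add.commute add_diff_cancel_left' diff_add_cancel diff_ge_0_iff_ge zero_less_one)
qed

text \<open>The form of \<open>pad L J\<close> at \<open>x\<close> is the form of \<open>L\<close>
  at \<open>y\<close>, the restriction of \<open>x\<close> to \<open>J\<close>, plus the squares of
  the coordinates outside \<open>J\<close>. For nonzero \<open>x\<close> at least one of the two is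
  positive.\<close>

lemma pad_sym_pos_def:
  fixes L :: "real^'n^'n"
  assumes L: "L \<in> sym_pos_def"
  shows "pad L J \<in> sym_pos_def"
proof -
  have sym: "L $ i $ j = L $ j $ i" for i j
    using L unfolding sym_pos_def_def by (metis (mono_tags, lifting) mem_Collect_eq transpose_def vec_lambda_beta)
  have "x \<bullet> (pad L J *v x) > 0" if "x \<noteq> 0" for x
  proof -
    define y :: "real^'n" where "y = (\<chi> i. if i \<in> J then x $ i else 0)"
    have row: "(pad L J *v x) $ i = (if i \<in> J then (L *v y) $ i else x $ i)" for i
    proof (cases "i \<in> J")
      case True
      then show ?thesis
        by (auto simp: matrix_vector_mult_def pad_def y_def intro!: sum.cong)
    next
      case False
      then have "(pad L J *v x) $ i = (\<Sum>j\<in>UNIV. (if i = j then 1 else 0) * x $ j)"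
        by (simp add: matrix_vector_mult_def pad_def)
      also have "\<dots> = (\<Sum>j\<in>UNIV. if i = j then x $ j else 0)"
        by (rule sum.cong) auto
      finally show ?thesis using False by simp
    qed
    have "x \<bullet> (pad L J *v x) = (\<Sum>i\<in>UNIV. y $ i * (L *v y) $ i + (if i \<in> J then 0 else (x $ i)\<^sup>2))"
      by (auto simp: inner_vec_def row y_def power2_eq_square intro!: sum.cong)
    then have split: "x \<bullet> (pad L J *v x) = y \<bullet> (L *v y) + (\<Sum>i\<in>UNIV. if i \<in> J then 0 else (x $ i)\<^sup>2)"
      by (simp add: inner_vec_def sum.distrib)
    have nonneg: "0 \<le> (\<Sum>i\<in>UNIV. if i \<in> J then 0 else (x $ i)\<^sup>2)"
      by (intro sum_nonneg) auto
    show ?thesis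
    proof (cases "y = 0")
      case False
      then have "y \<bullet> (L *v y) > 0" using L by (simp add: sym_pos_def_def)
      then show ?thesis using split nonneg by simp
    next
      case True
      from that obtain k where "x $ k \<noteq> 0" by (auto simp: vec_eq_iff)
      moreover from this have "k \<notin> J" using arg_cong[OF True, of "\<lambda>y. y $ k"] by (auto simp: y_def)
      ultimately have "0 < (\<Sum>i\<in>UNIV. if i \<in> J then 0 else (x $ i)\<^sup>2)"
        by (intro sum_pos2[of _ k]) auto
      then show ?thesis using split True by simp
    qed
  qed
  moreover have "transpose (pad L J) = pad L J"
    using sym by (auto simp: transpose_def pad_def vec_eq_iff)
  ultimately show ?thesis by (simp add: sym_pos_def_def)
qed

lemma principal_minor_pos: "L \<in> sym_pos_def \<Longrightarrow> principal_minor L J > 0"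
  using sym_pos_def_det_pos[OF pad_sym_pos_def] by (simp add: det_pad)

lemma principal_minor_le_det_plus_mat_1:
  assumes "L \<in> sym_pos_def"
  shows "principal_minor L J \<le> det (L + mat 1)"
  unfolding sum_principal_minor[symmetric]
  by (rule member_le_sum) (use principal_minor_pos[OF assms] in \<open>auto intro: less_imp_le\<close>)

lemma det_plus_mat_1_ge_1: "L \<in> sym_pos_def \<Longrightarrow> det (L + mat 1) \<ge> 1"
  using principal_minor_le_det_plus_mat_1[of L "{}"] by (simp add: principal_minor_empty)

lemma dpp_prob_pos: "L \<in> sym_pos_def \<Longrightarrow> dpp_prob L J > 0"
  using principal_minor_pos[of L J] det_plus_mat_1_ge_1[of L] by (simp add: dpp_prob_def)

lemma sum_dpp_prob:
  assumes "L \<in> sym_pos_def"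
  shows "(\<Sum>J\<in>UNIV. dpp_prob L J) = 1"
  using det_plus_mat_1_ge_1[OF assms]
  by (simp add: dpp_prob_def sum_divide_distrib[symmetric] sum_principal_minor)

lemma dpp_prob_le_1: "L \<in> sym_pos_def \<Longrightarrow> dpp_prob L J \<le> 1"
  using principal_minor_le_det_plus_mat_1[of L J] det_plus_mat_1_ge_1[of L] by (simp add: dpp_prob_def)

lemma continuous_on_dpp_prob:
  "continuous_on sym_pos_def (\<lambda>L::real^'n^'n. dpp_prob L J)"
proof -
  have "continuous_on sym_pos_def (\<lambda>L::real^'n^'n. principal_minor L J / principal_minor (L + mat 1) UNIV)"
    using det_plus_mat_1_ge_1 by (intro continuous_intros) (fastforce simp: principal_minor_UNIV)
  then show ?thesis by (simp add: dpp_prob_def principal_minor_UNIV)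
qed

text \<open>The kernel of a positive semidefinite \<open>L\<close> consists of the \<open>x\<close> with \<open>x \<bullet> L x = 0\<close>: otherwise
  the form would be negative at \<open>x + t L x\<close> for a small negative \<open>t\<close>.\<close>

lemma sym_pos_def_if_semidefinite:
  fixes L :: "real^'n^'n"
  assumes sym: "transpose L = L" and psd: "\<And>x. x \<bullet> (L *v x) \<ge> 0" and det: "det L \<noteq> 0"
  shows "L \<in> sym_pos_def"
proof -
  have "x = 0" if 0: "x \<bullet> (L *v x) = 0" for x
  proof -
    \<comment> \<open>The form at \<open>x + t w\<close> is \<open>t * (2 * a + t * b)\<close>. Its
      minimum over \<open>t\<close> would be at \<open>- a / b\<close>; the added 1 keeps the
      denominator positive when \<open>b = 0\<close>, and the value is still negative unless
      \<open>a = 0\<close>.\<close>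
    define w a b t where "w = L *v x" and "a = w \<bullet> w" and "b = w \<bullet> (L *v w)" and "t = - a / (b + 1)"
    have "b \<ge> 0" using psd by (simp add: b_def)
    have "x \<bullet> (L *v w) = w \<bullet> w"
      by (metis sym dot_lmul_matrix transpose_matrix_vector w_def inner_commute)
    then have "(x + t *\<^sub>R w) \<bullet> (L *v (x + t *\<^sub>R w)) = t * (2 * a + t * b)"
      using 0 by (simp add: matrix_vector_right_distrib matrix_vector_mult_scaleR inner_add_left
          inner_add_right a_def b_def w_def[symmetric] algebra_simps)
    then have "0 \<le> t * (2 * a + t * b)" by (metis psd)
    moreover have "2 * a + t * b = a * (b + 2) / (b + 1)"
      using \<open>b \<ge> 0\<close> by (simp add: t_def field_simps)
    ultimately have "0 \<le> - (a\<^sup>2 * (b + 2) / (b + 1)\<^sup>2)"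
      by (simp add: t_def power2_eq_square)
    then have "a\<^sup>2 * (b + 2) / (b + 1)\<^sup>2 \<le> 0" by simp
    then have "a = 0" using \<open>b \<ge> 0\<close> by (simp add: divide_le_0_iff mult_le_0_iff)
    then have "L *v x = 0" by (simp add: a_def w_def)
    then show "x = 0"
      using det by (metis invertible_det_nz invertible_left_inverse matrix_left_invertible_ker)
  qed
  then show ?thesis
    using sym psd by (auto simp: sym_pos_def_def) (metis order_le_less psd)
qed

section \<open>Compact sets of positive definite matrices\<close>

lemma compact_semidefinite_det_ge:
  "compact {L :: real^'n^'n. transpose L = L \<and> (\<forall>x. x \<bullet> (L *v x) \<ge> 0) \<and> det L \<ge> e \<and>
     (\<forall>i j. \<bar>L $ i $ j\<bar> \<le> c)}" (is "compact ?K")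
proof (rule compact_eq_bounded_closed[THEN iffD2], intro conjI)
  have "norm L \<le> (\<Sum>i\<in>(UNIV::'n set). \<Sum>j\<in>(UNIV::'n set). c)" if "L \<in> ?K" for L
  proof -
    have "norm L \<le> (\<Sum>i\<in>UNIV. norm (L $ i))"
      unfolding norm_vec_def by (rule L2_set_le_sum) simp
    also have "\<dots> \<le> (\<Sum>i\<in>UNIV. \<Sum>j\<in>UNIV. \<bar>L $ i $ j\<bar>)"
      by (intro sum_mono norm_le_l1_cart)
    also have "\<dots> \<le> (\<Sum>i\<in>(UNIV::'n set). \<Sum>j\<in>(UNIV::'n set). c)"
      using that by (intro sum_mono) auto
    finally show ?thesis .
  qed
  then show "bounded ?K" by (intro boundedI)
  have det: "det = (\<lambda>L::real^'n^'n. principal_minor L UNIV)"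
    by (simp add: fun_eq_iff principal_minor_UNIV)
  have form: "continuous_on UNIV (\<lambda>L::real^'n^'n. x \<bullet> (L *v x))" for x
    unfolding matrix_vector_mult_def inner_vec_def by (simp, intro continuous_intros)
  have tr: "continuous_on UNIV (transpose :: real^'n^'n \<Rightarrow> _)"
    unfolding transpose_def by (intro continuous_intros)
  show "closed ?K"
    by (intro closed_Collect_conj closed_Collect_all closed_Collect_le closed_Collect_eq
        continuous_intros form tr) (simp add: det, intro continuous_intros)
qed

text \<open>Positive definiteness is not a closed condition. Semidefiniteness with a lower bound on
  the determinant is closed, and for \<open>e > 0\<close> it still implies positive
  definiteness.\<close>

definition confined :: "real \<Rightarrow> (real^'n^'n) set" where
  "confined e = {L. transpose L = L \<and> (\<forall>x. x \<bullet> (L *v x) \<ge> 0) \<and> det L \<ge> e \<and> (\<forall>i j. \<bar>L $ i $ j\<bar> \<le> 1 / e)}"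

lemma compact_confined: "compact (confined e)"
  unfolding confined_def by (rule compact_semidefinite_det_ge)

lemma confined_subset: "e > 0 \<Longrightarrow> confined e \<subseteq> sym_pos_def"
  by (auto simp: confined_def intro!: sym_pos_def_if_semidefinite)

text \<open>The probability of the empty set bounds \<open>det (L + mat 1)\<close> by
  \<open>1 / e\<close>, hence the diagonal entries; the probability of the full set bounds
  \<open>det L\<close> from below. Off-diagonal entries are controlled by diagonal ones through
  semidefiniteness.\<close>

lemma confinedI:
  fixes L :: "real^'n^'n"
  assumes L: "L \<in> sym_pos_def" and e: "e > 0" and ge: "\<And>J. dpp_prob L J \<ge> e"
  shows "L \<in> confined e"
proof -
  let ?D = "det (L + mat 1)"
  have D: "?D \<ge> 1" using det_plus_mat_1_ge_1[OF L] .
  have sym: "L $ i $ j = L $ j $ i" for i j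
    using L unfolding sym_pos_def_def by (metis (mono_tags, lifting) mem_Collect_eq transpose_def vec_lambda_beta)
  have "e \<le> 1 / ?D" using ge[of "{}"] by (simp add: dpp_prob_def principal_minor_empty)
  then have D2: "?D \<le> 1 / e" using e D by (simp add: field_simps)
  have "e \<le> det L / ?D" using ge[of UNIV] by (simp add: dpp_prob_def principal_minor_UNIV)
  then have "e * ?D \<le> det L" using D by (simp add: field_simps)
  moreover have "e * 1 \<le> e * ?D" using D e by (intro mult_left_mono) auto
  ultimately have detL: "e \<le> det L" by simp
  have psd: "0 \<le> x \<bullet> (L *v x)" for x
    using L by (cases "x = 0") (auto simp: sym_pos_def_def intro: less_imp_le)
  have diag: "L $ i $ i \<le> 1 / e" for i
    using principal_minor_le_det_plus_mat_1[OF L, of "{i}"] D2 by simp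
  \<comment> \<open>Used with \<open>s = 1\<close> and \<open>s = -1\<close>, this gives
    \<open>2 * \<bar>L $ i $ j\<bar> \<le> L $ i $ i + L $ j $ j\<close>.\<close>
  have quad: "(axis i 1 + s *\<^sub>R axis j 1) \<bullet> (L *v (axis i 1 + s *\<^sub>R axis j 1))
      = L $ i $ i + 2 * s * L $ i $ j + s\<^sup>2 * L $ j $ j" for i j s
    using sym[of j i]
    by (simp add: matrix_vector_right_distrib matrix_vector_mult_scaleR inner_add_left
        inner_axis' matrix_vector_mult_basis column_def power2_eq_square algebra_simps)
  have "\<bar>L $ i $ j\<bar> \<le> 1 / e" for i j
    using psd[of "axis i 1 + 1 *\<^sub>R axis j 1"] psd[of "axis i 1 + (-1) *\<^sub>R axis j 1"]
      diag[of i] diag[of j] unfolding quad by simp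
  then show ?thesis
    using L psd detL by (auto simp: confined_def sym_pos_def_def)
qed

section \<open>Almost sure convergence of the empirical frequencies\<close>

definition empirical_frequency :: "nat \<Rightarrow> (nat \<Rightarrow> 'a) \<Rightarrow> 'a \<Rightarrow> real" where
  "empirical_frequency n z J = (\<Sum>i<n. if z i = J then 1 else 0) / real n"

text \<open>The indicators of \<open>Z i = J\<close> are independent, identically distributed and
  lie in \<open>[0,1]\<close>. Hoeffding bounds the deviation probabilities by a geometric sequence,
  so Borel-Cantelli excludes infinitely many deviations of any fixed size.\<close>

lemma (in prob_space) AE_empirical_frequency_tendsto:
  fixes Z :: "nat \<Rightarrow> 'a \<Rightarrow> 'b"
  assumes indep: "indep_vars (\<lambda>_. count_space UNIV) Z UNIV"
    and distr: "\<And>i. distr M (count_space UNIV) (Z i) = P"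
  shows "AE \<omega> in M. (\<lambda>n. empirical_frequency n (\<lambda>i. Z i \<omega>) J) \<longlonglongrightarrow> measure P {J}"
proof -
  have Z [measurable]: "Z i \<in> measurable M (count_space UNIV)" for i
    using indep by (auto simp: indep_vars_def)
  define g :: "'b \<Rightarrow> real" where "g x = (if x = J then 1 else 0)" for x
  have [measurable]: "g \<in> borel_measurable (count_space UNIV)" by simp
  define X where "X i \<omega> = g (Z i \<omega>)" for i \<omega>
  have X [measurable]: "X i \<in> borel_measurable M" for i
    unfolding X_def by measurable
  have freq: "empirical_frequency n (\<lambda>i. Z i \<omega>) J = (\<Sum>i<n. X i \<omega>) / real n" for n \<omega>
    by (simp add: empirical_frequency_def X_def g_def)
  have mean: "measure P {J} = expectation (X 0)"
  proof -
    have "expectation (X 0) = expectation (indicator (Z 0 -` {J} \<inter> space M))"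
      by (intro Bochner_Integration.integral_cong) (auto simp: X_def g_def indicator_def)
    also have "\<dots> = measure M (Z 0 -` {J} \<inter> space M)"
      by simp
    also have "\<dots> = measure P {J}"
      unfolding distr[of 0, symmetric] by (subst measure_distr) auto
    finally show ?thesis by simp
  qed
  have hoeffding: "prob {\<omega>\<in>space M. \<bar>(\<Sum>i<n. X i \<omega>) / real n - measure P {J}\<bar> \<ge> e} \<le> 2 * exp (-2 * real n * e\<^sup>2)"
    if "n > 0" "e > 0" for n e
  proof -
    interpret H: Hoeffding_ineq_iid M "{..<n}" X "X 0" 0 1 "measure P {J}"
    proof unfold_locales
      have "indep_vars (\<lambda>_. borel) (\<lambda>i. g \<circ> Z i) {..<n}"
        by (rule indep_vars_compose[OF indep_vars_subset[OF indep]]) auto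
      then show "indep_vars (\<lambda>_. borel) X {..<n}"
        by (simp add: X_def[abs_def] o_def)
      show "distr M borel (X i) = distr M borel (X 0)" for i
      proof -
        have "distr M borel (X i) = distr (distr M (count_space UNIV) (Z i)) borel g" for i
          by (subst distr_distr) (auto simp: X_def[abs_def] o_def)
        then show ?thesis by (simp add: distr)
      qed
      show "measure P {J} \<equiv> expectation (X 0)" using mean by simp
    qed (auto simp: X_def g_def)
    show ?thesis
      using H.Hoeffding_ineq_abs_ge'[of e] that by (simp add: lessThan_empty_iff)
  qed
  have "AE \<omega> in M. eventually (\<lambda>n. \<bar>empirical_frequency n (\<lambda>i. Z i \<omega>) J - measure P {J}\<bar> < e) sequentially"
    if e: "e > 0" for e
  proof -
    let ?A = "\<lambda>n. {\<omega>\<in>space M. \<bar>(\<Sum>i<n. X i \<omega>) / real n - measure P {J}\<bar> \<ge> e}"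
    have "summable (\<lambda>n. 2 * exp (-2 * e\<^sup>2) ^ n)"
      using e by (intro summable_mult summable_geometric) auto
    moreover have "norm (prob (?A n)) \<le> 2 * exp (-2 * e\<^sup>2) ^ n" for n
    proof (cases "n = 0")
      \<comment> \<open>Hoeffding is available only for \<open>n > 0\<close>; at
        \<open>n = 0\<close> the bound is 2, which every probability satisfies.\<close>
      case True
      have "norm (prob (?A n)) \<le> 2"
        using prob_le_1[of "?A n"] measure_nonneg[of M "?A n"] unfolding real_norm_def by linarith
      also have "\<dots> = 2 * exp (-2 * e\<^sup>2) ^ n" using True by simp
      finally show ?thesis .
    next
      case False
      then show ?thesis
        using hoeffding[of n e] e by (simp add: exp_of_nat_mult[symmetric] mult_ac)
    qed
    ultimately have "summable (\<lambda>n. prob (?A n))"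
      by (rule summable_comparison_test'[where N = 0])
    then have "AE \<omega> in M. eventually (\<lambda>n. \<omega> \<in> space M - ?A n) sequentially"
      by (intro borel_cantelli_AE1) (auto simp: emeasure_eq_measure)
    then show ?thesis
    proof (rule AE_mp, intro AE_I2 impI)
      fix \<omega> assume "\<omega> \<in> space M" "eventually (\<lambda>n. \<omega> \<in> space M - ?A n) sequentially"
      then show "eventually (\<lambda>n. \<bar>empirical_frequency n (\<lambda>i. Z i \<omega>) J - measure P {J}\<bar> < e) sequentially"
        by (auto simp: freq elim!: eventually_mono)
    qed
  qed
  \<comment> \<open>Only the thresholds \<open>inverse (real (Suc k))\<close> are kept, so that the
    exceptional null sets are countably many and can be united.\<close>
  then have "AE \<omega> in M. \<forall>k. eventually (\<lambda>n.
      \<bar>empirical_frequency n (\<lambda>i. Z i \<omega>) J - measure P {J}\<bar> < inverse (real (Suc k))) sequentially"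
    by (subst AE_all_countable) simp
  then show ?thesis
  proof (rule AE_mp, intro AE_I2 impI)
    fix \<omega> assume *: "\<forall>k. eventually (\<lambda>n.
      \<bar>empirical_frequency n (\<lambda>i. Z i \<omega>) J - measure P {J}\<bar> < inverse (real (Suc k))) sequentially"
    show "(\<lambda>n. empirical_frequency n (\<lambda>i. Z i \<omega>) J) \<longlonglongrightarrow> measure P {J}"
    proof (rule tendstoI)
      fix e :: real assume "e > 0"
      then obtain k where "inverse (real (Suc k)) < e" using reals_Archimedean by blast
      then show "eventually (\<lambda>n. dist (empirical_frequency n (\<lambda>i. Z i \<omega>) J) (measure P {J}) < e) sequentially"
        using *[rule_format, of k] by (auto simp: dist_real_def elim: eventually_mono)
    qed
  qed
qed

section \<open>Gibbs' inequality and existence of maximizers\<close>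

text \<open>The equality case of Gibbs' inequality. With \<open>r = q x / p x\<close>, the terms
  \<open>p x * (r - 1 - ln r)\<close> are nonnegative, and equal totals make their sum the relative
  entropy, which \<open>ge\<close> forces to vanish. Finally \<open>ln r = r - 1\<close> only at
  \<open>r = 1\<close>.\<close>

lemma sum_mult_ln_eq_imp_eq:
  fixes p q :: "'a \<Rightarrow> real"
  assumes "finite S" and p: "\<And>x. x \<in> S \<Longrightarrow> p x > 0" and q: "\<And>x. x \<in> S \<Longrightarrow> q x > 0"
    and "sum p S = sum q S" and ge: "(\<Sum>x\<in>S. p x * ln (q x)) \<ge> (\<Sum>x\<in>S. p x * ln (p x))"
    and x: "x \<in> S"
  shows "q x = p x"
proof -
  define g where "g x = p x * (q x / p x - 1 - ln (q x / p x))" for x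
  have g: "g x = q x - p x - (p x * ln (q x) - p x * ln (p x))" if "x \<in> S" for x
    using p[OF that] q[OF that] by (simp add: g_def ln_div algebra_simps)
  have nonneg: "g x \<ge> 0" if "x \<in> S" for x
    using p[OF that] q[OF that] ln_le_minus_one[of "q x / p x"] by (simp add: g_def)
  have "sum g S = (\<Sum>x\<in>S. p x * ln (p x)) - (\<Sum>x\<in>S. p x * ln (q x))"
    using assms(4) by (simp add: g sum_subtractf cong: sum.cong)
  then have "sum g S = 0" using ge sum_nonneg[of S g] nonneg by simp
  then have "g x = 0" using sum_nonneg_eq_0_iff[of S g] \<open>finite S\<close> nonneg x by auto
  then have "ln (q x / p x) = q x / p x - 1" using p[OF x] by (simp add: g_def)
  then have "q x / p x = 1" using p[OF x] q[OF x] by (intro ln_eq_minus_one) auto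
  then show ?thesis using p[OF x] by simp
qed

text \<open>Allowing any weights treats the sample, with its empirical frequencies, and the limit,
  with the true probabilities, as one functional.\<close>

definition weighted_log_likelihood :: "('n set \<Rightarrow> real) \<Rightarrow> real^'n^'n \<Rightarrow> real" where
  "weighted_log_likelihood p L = (\<Sum>J\<in>UNIV. p J * ln (dpp_prob L J))"

text \<open>No summand is positive because probabilities are at most 1, so each single one already
  exceeds \<open>c\<close>: \<open>c \<le> p J * ln (dpp_prob L J) \<le> \<delta> * ln (dpp_prob L
  J)\<close>.\<close>

lemma dpp_prob_ge_exp:
  fixes L :: "real^'n^'n"
  assumes L: "L \<in> sym_pos_def" and \<delta>: "\<delta> > 0" and p: "\<And>J. p J \<ge> \<delta>"
    and ge: "weighted_log_likelihood p L \<ge> c"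
  shows "dpp_prob L J \<ge> exp (c / \<delta>)"
proof -
  have ln: "ln (dpp_prob L K) \<le> 0" for K
    using dpp_prob_le_1[OF L] dpp_prob_pos[OF L] by simp
  have "weighted_log_likelihood p L = p J * ln (dpp_prob L J) + (\<Sum>K\<in>UNIV - {J}. p K * ln (dpp_prob L K))"
    unfolding weighted_log_likelihood_def by (rule sum.remove) auto
  moreover have "(\<Sum>K\<in>UNIV - {J}. p K * ln (dpp_prob L K)) \<le> 0"
    using p \<delta> ln by (intro sum_nonpos mult_nonneg_nonpos) (auto intro: order_trans less_imp_le)
  moreover have "p J * ln (dpp_prob L J) \<le> \<delta> * ln (dpp_prob L J)"
    using p ln by (intro mult_right_mono_neg)
  ultimately have "c / \<delta> \<le> ln (dpp_prob L J)"
    using ge \<delta> by (simp add: field_simps)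
  then show ?thesis
    using dpp_prob_pos[OF L] by (metis exp_le_cancel_iff exp_ln)
qed

lemma weighted_log_likelihood_imp_confined:
  assumes "L \<in> sym_pos_def" "\<delta> > 0" "\<And>J. p J \<ge> \<delta>" "weighted_log_likelihood p L \<ge> c"
  shows "L \<in> confined (exp (c / \<delta>))"
  using assms by (intro confinedI dpp_prob_ge_exp) auto

lemma tendsto_weighted_log_likelihood:
  assumes "\<And>J. (\<lambda>n. p n J) \<longlonglongrightarrow> q J" "l \<in> sym_pos_def" "\<And>n. L n \<in> sym_pos_def" "L \<longlonglongrightarrow> l"
  shows "(\<lambda>n. weighted_log_likelihood (p n) (L n)) \<longlonglongrightarrow> weighted_log_likelihood q l"
proof -
  have "(\<lambda>n. dpp_prob (L n) J) \<longlonglongrightarrow> dpp_prob l J" for J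
    using continuous_on_tendsto_compose[OF continuous_on_dpp_prob assms(4,2)] assms(3) by auto
  then show ?thesis
    unfolding weighted_log_likelihood_def
    using dpp_prob_pos[OF assms(2)] by (intro tendsto_intros assms(1)) (auto simp: less_le)
qed

text \<open>The identity matrix serves as a benchmark: every matrix at least as good lies in one
  compact set, where the maximum is attained, and all others are worse than the benchmark.\<close>

lemma weighted_log_likelihood_has_maximizer:
  fixes p :: "'n::finite set \<Rightarrow> real"
  assumes p: "\<And>J. p J > 0"
  shows "\<exists>L. is_arg_max (weighted_log_likelihood p) (\<lambda>K. K \<in> sym_pos_def) L"
proof -
  define \<delta> where "\<delta> = Min (range p)"
  have \<delta>: "\<delta> > 0" "p J \<ge> \<delta>" for J using p by (auto simp: \<delta>_def)
  let ?f = "weighted_log_likelihood p" and ?I = "mat 1 :: real^'n^'n"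
  let ?K = "confined (exp (?f ?I / \<delta>)) :: (real^'n^'n) set"
  have K: "?K \<subseteq> sym_pos_def" by (rule confined_subset) simp
  have in_K: "L \<in> ?K" if "L \<in> sym_pos_def" "?f L \<ge> ?f ?I" for L
    using weighted_log_likelihood_imp_confined that \<delta> by blast
  have "continuous_on sym_pos_def ?f"
    unfolding weighted_log_likelihood_def
    using dpp_prob_pos by (intro continuous_intros continuous_on_dpp_prob) (auto simp: less_le)
  then have "continuous_on ?K ?f" using K by (rule continuous_on_subset)
  moreover have I: "?I \<in> ?K" using in_K mat_1_sym_pos_def by blast
  ultimately obtain L where L: "L \<in> ?K" "\<And>L'. L' \<in> ?K \<Longrightarrow> ?f L' \<le> ?f L"
    using continuous_attains_sup[OF compact_confined, of _ ?f] by blast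
  have "?f L' \<le> ?f L" if "L' \<in> sym_pos_def" for L'
    using L in_K[OF that] I by fastforce
  then show ?thesis using L(1) K by (auto simp: is_arg_max_linorder)
qed

section \<open>Identifiability up to signs, and convergence of maximizers\<close>

text \<open>The probability of the empty set is the reciprocal of the normalising constant. Hence
  the constants agree, and with them all principal minors.\<close>

lemma dpp_prob_eq_imp_sign_similar:
  fixes L K :: "real^'n^'n"
  assumes L: "L \<in> sym_pos_def" and K: "K \<in> sym_pos_def" and eq: "\<And>J. dpp_prob L J = dpp_prob K J"
  obtains D where "D \<in> sign_matrices" "L = D ** K ** D"
proof -
  have "det (L + mat 1) = det (K + mat 1)"
    using eq[of "{}"] by (simp add: dpp_prob_def principal_minor_empty)
  then have minors: "principal_minor K J = principal_minor L J" for J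
    using eq[of J] det_plus_mat_1_ge_1[OF K] by (simp add: dpp_prob_def)
  obtain d where d: "\<And>i. d i \<in> {1, - 1 :: real}" "\<And>i j. L $ i $ j = d i * d j * K $ i $ j"
    using sign_similar_if_principal_minors_eq[of UNIV K L] minors principal_minor_pos[OF K] L K
    by (auto simp: sym_pos_def_def less_le)
  define D :: "real^'n^'n" where "D = (\<chi> i j. if i = j then d i else 0)"
  have "D \<in> sign_matrices" using d(1) by (auto simp: sign_matrices_def D_def)
  moreover have "L = D ** K ** D"
    using d(2) by (simp add: vec_eq_iff matrix_matrix_mult_def D_def if_distrib[where f = "\<lambda>c. c * _"]
        if_distrib[where f = "\<lambda>c. _ * c"] mult_ac cong: if_cong)
  ultimately show ?thesis by (rule that)
qed

lemma dpp_loss_le: "D \<in> sign_matrices \<Longrightarrow> dpp_loss A B \<le> norm (A - D ** B ** D)"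
  unfolding dpp_loss_def frobenius_norm_eq_norm by (intro Min_le) (auto intro: finite_sign_matrices)

lemma dpp_loss_nonneg: "dpp_loss A B \<ge> 0"
  unfolding dpp_loss_def frobenius_norm_eq_norm
  by (subst Min_ge_iff) (auto simp: finite_sign_matrices sign_matrices_nonempty)

text \<open>The deterministic core, to be applied along a single sample path with \<open>p n\<close>
  its empirical frequencies.\<close>

lemma dpp_loss_argmax_tendsto_0:
  fixes Lstar :: "real^'n^'n"
  assumes Lstar: "Lstar \<in> sym_pos_def"
    and p: "\<And>J. (\<lambda>n. p n J) \<longlonglongrightarrow> dpp_prob Lstar J"
    and max: "eventually (\<lambda>n. is_arg_max (weighted_log_likelihood (p n)) (\<lambda>K. K \<in> sym_pos_def) (L n)) sequentially"
  shows "(\<lambda>n. dpp_loss (L n) Lstar) \<longlonglongrightarrow> 0"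
proof -
  let ?f = weighted_log_likelihood
  \<comment> \<open>Half of the least true probability, so that the converging weights eventually
    all exceed it.\<close>
  define \<delta> where "\<delta> = Min (range (dpp_prob Lstar)) / 2"
  have \<delta>: "\<delta> > 0" "\<delta> < dpp_prob Lstar J" for J
  proof -
    show "\<delta> > 0" using dpp_prob_pos[OF Lstar] by (auto simp: \<delta>_def)
    moreover have "Min (range (dpp_prob Lstar)) \<le> dpp_prob Lstar J" by simp
    ultimately show "\<delta> < dpp_prob Lstar J" unfolding \<delta>_def by linarith
  qed
  \<comment> \<open>The slack 1 keeps \<open>c\<close> strictly below the limit of the likelihoods
    of \<open>Lstar\<close>; hence these eventually exceed \<open>c\<close>, and so do those of the
    maximizers.\<close>
  define c where "c = ?f (dpp_prob Lstar) Lstar - 1"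
  define K :: "(real^'n^'n) set" where "K = confined (exp (c / \<delta>))"
  have K: "K \<subseteq> sym_pos_def" unfolding K_def by (rule confined_subset) simp
  have "eventually (\<lambda>n. \<forall>J. \<delta> < p n J) sequentially"
    using order_tendstoD(1)[OF p \<delta>(2)] by (intro eventually_all_finite)
  moreover have "(\<lambda>n. ?f (p n) Lstar) \<longlonglongrightarrow> ?f (dpp_prob Lstar) Lstar"
    by (rule tendsto_weighted_log_likelihood) (auto simp: p Lstar)
  then have "eventually (\<lambda>n. c < ?f (p n) Lstar) sequentially"
    by (rule order_tendstoD) (simp add: c_def)
  ultimately have "eventually (\<lambda>n. L n \<in> K \<and> ?f (p n) (L n) \<ge> ?f (p n) Lstar) sequentially"
    using max
  proof eventually_elim
    case (elim n)
    then have Ln: "L n \<in> sym_pos_def" "?f (p n) (L n) \<ge> ?f (p n) Lstar"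
      using Lstar by (auto simp: is_arg_max_linorder)
    then have "L n \<in> K"
      unfolding K_def using elim \<delta>(1)
      by (intro weighted_log_likelihood_imp_confined[where p = "p n"]) (auto intro: less_imp_le)
    with Ln show ?case by blast
  qed
  then obtain N where N: "\<And>n. n \<ge> N \<Longrightarrow> L n \<in> K" "\<And>n. n \<ge> N \<Longrightarrow> ?f (p n) (L n) \<ge> ?f (p n) Lstar"
    by (auto simp: eventually_sequentially)
  show ?thesis
  proof (rule ccontr)
    assume "\<not> ?thesis"
    then obtain \<eta> where \<eta>: "\<eta> > 0" "\<And>m. \<exists>n\<ge>m. dpp_loss (L n) Lstar \<ge> \<eta>"
      using dpp_loss_nonneg[of "L _" Lstar] by (auto simp: LIMSEQ_iff not_less)
    \<comment> \<open>Bad indices are picked beyond \<open>N\<close>, where the maximizers lie in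
      \<open>K\<close>, and beyond \<open>k\<close>. The sequence \<open>r\<close> may fail to be
      monotone, but \<open>r k \<ge> k\<close> is enough for every subsequence of it to tend to
      infinity.\<close>
    have "\<forall>k. \<exists>n. n \<ge> N + k \<and> dpp_loss (L n) Lstar \<ge> \<eta>" using \<eta>(2) by blast
    from choice[OF this]
    obtain r where r: "\<And>k. r k \<ge> N + k" "\<And>k. dpp_loss (L (r k)) Lstar \<ge> \<eta>"
      by blast
    have "seq_compact K"
      unfolding K_def by (rule compact_imp_seq_compact[OF compact_confined])
    moreover have "\<forall>k. L (r k) \<in> K" using N(1) r(1) by (meson add_leD1)
    ultimately obtain l s where l: "l \<in> K" and s: "strict_mono s" "((\<lambda>k. L (r k)) \<circ> s) \<longlonglongrightarrow> l"
      by (rule seq_compactE)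
    define u where "u k = r (s k)" for k
    have u: "u k \<ge> N" "u k \<ge> k" for k
      using r(1)[of "s k"] seq_suble[OF s(1), of k] by (auto simp: u_def)
    have lim_u: "filterlim u at_top sequentially"
      by (rule filterlim_at_top_mono[OF filterlim_ident]) (simp add: u)
    have pu: "(\<lambda>k. p (u k) J) \<longlonglongrightarrow> dpp_prob Lstar J" for J
      by (rule filterlim_compose[OF p lim_u])
    have Lu: "(\<lambda>k. L (u k)) \<longlonglongrightarrow> l" using s(2) by (simp add: u_def o_def)
    have l': "l \<in> sym_pos_def" using l K by blast
    \<comment> \<open>The comparison of each maximizer with \<open>Lstar\<close> passes to the
      limit, with weights and matrices converging together. This is the reverse of Gibbs'
      inequality, so equality holds.\<close>
    have "?f (dpp_prob Lstar) Lstar \<le> ?f (dpp_prob Lstar) l"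
    proof (rule LIMSEQ_le)
      show "(\<lambda>k. ?f (p (u k)) Lstar) \<longlonglongrightarrow> ?f (dpp_prob Lstar) Lstar"
        by (rule tendsto_weighted_log_likelihood) (auto simp: pu Lstar)
      show "(\<lambda>k. ?f (p (u k)) (L (u k))) \<longlonglongrightarrow> ?f (dpp_prob Lstar) l"
        by (rule tendsto_weighted_log_likelihood) (use pu l' Lu N(1) K u in auto)
    qed (use N(2) u in blast)
    then have "dpp_prob l J = dpp_prob Lstar J" for J
      using sum_mult_ln_eq_imp_eq[of UNIV "dpp_prob Lstar" "dpp_prob l" J]
      by (simp add: weighted_log_likelihood_def dpp_prob_pos Lstar l' sum_dpp_prob)
    then obtain D where D: "D \<in> sign_matrices" "l = D ** Lstar ** D"
      using dpp_prob_eq_imp_sign_similar[OF l' Lstar] by metis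
    have "(\<lambda>k. norm (L (u k) - l)) \<longlonglongrightarrow> 0"
      using Lu by (simp add: LIM_zero_iff tendsto_norm_zero_iff)
    \<comment> \<open>The loss is a minimum over sign matrices, so it is at most the distance
      obtained with this particular \<open>D\<close>.\<close>
    moreover have "\<eta> \<le> norm (L (u k) - l)" for k
      using r(2)[of "s k"] dpp_loss_le[OF D(1), of "L (u k)" Lstar] D(2) by (simp add: u_def)
    ultimately have "\<eta> \<le> 0" by (intro LIMSEQ_le_const) auto
    then show False using \<eta>(1) by simp
  qed
qed

section \<open>From the random sample to the deterministic statement\<close>

text \<open>The sum over the sample is regrouped by the value of \<open>z i\<close>. For
  \<open>n = 0\<close> both sides are zero, since division by zero gives zero.\<close>

lemma log_likelihood_eq_weighted:
  fixes z :: "nat \<Rightarrow> 'n::finite set"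
  shows "log_likelihood n z = weighted_log_likelihood (empirical_frequency n z)"
proof
  fix L :: "real^'n^'n"
  have "(\<Sum>i<n. ln (dpp_prob L (z i))) = (\<Sum>i<n. \<Sum>J\<in>UNIV. (if z i = J then 1 else 0) * ln (dpp_prob L J))"
    by (simp add: if_distrib[where f = "\<lambda>c. c * _"] cong: if_cong)
  also have "\<dots> = (\<Sum>J\<in>UNIV. (\<Sum>i<n. if z i = J then 1 else 0) * ln (dpp_prob L J))"
    by (subst sum.swap) (simp add: sum_distrib_right)
  finally show "log_likelihood n z L = weighted_log_likelihood (empirical_frequency n z) L"
    by (simp only: log_likelihood_def weighted_log_likelihood_def empirical_frequency_def
        sum_distrib_left times_divide_eq_left mult_1_left)
qed

lemma measure_DPP_singleton:
  assumes "L \<in> sym_pos_def"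
  shows "measure (DPP L) {J} = dpp_prob L J"
  using dpp_prob_pos[OF assms, of J]
  by (simp add: DPP_def measure_def emeasure_point_measure_finite)

theorem theorem3p3:
  fixes M :: "'w measure"
    and Lstar :: "real^'n^'n"
    and Z :: "nat \<Rightarrow> 'w \<Rightarrow> 'n set"
    and Lhat :: "nat \<Rightarrow> 'w \<Rightarrow> real^'n^'n"
  assumes "prob_space M"
    and "Lstar \<in> sym_pos_def"
    and "prob_space.indep_vars M (\<lambda>_. count_space UNIV) Z UNIV"
    and "\<And>i. distr M (count_space UNIV) (Z i) = DPP Lstar"
    and "\<And>n \<omega>. n \<ge> 1 \<Longrightarrow> \<omega> \<in> space M \<Longrightarrow> \<exists>L. is_MLE n (\<lambda>i. Z i \<omega>) L
           \<Longrightarrow> is_MLE n (\<lambda>i. Z i \<omega>) (Lhat n \<omega>)"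
  shows "AE \<omega> in M. (\<lambda>n. dpp_loss (Lhat n \<omega>) Lstar) \<longlonglongrightarrow> 0"
proof -
  interpret prob_space M by fact
  have "AE \<omega> in M. (\<lambda>n. empirical_frequency n (\<lambda>i. Z i \<omega>) J) \<longlonglongrightarrow> dpp_prob Lstar J" for J
    using AE_empirical_frequency_tendsto[OF assms(3,4)]
    unfolding measure_DPP_singleton[OF assms(2)] .
  \<comment> \<open>There are finitely many subsets \<open>J\<close>, so their exceptional null sets
    can be united.\<close>
  then have "AE \<omega> in M. \<forall>J. (\<lambda>n. empirical_frequency n (\<lambda>i. Z i \<omega>) J) \<longlonglongrightarrow> dpp_prob Lstar J"
    by (subst AE_finite_all[of UNIV, simplified]) auto
  then show ?thesis
  proof (rule AE_mp, intro AE_I2 impI)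
    fix \<omega> assume \<omega>: "\<omega> \<in> space M"
      and *: "\<forall>J. (\<lambda>n. empirical_frequency n (\<lambda>i. Z i \<omega>) J) \<longlonglongrightarrow> dpp_prob Lstar J"
    \<comment> \<open>Once every subset has been observed, a maximizer exists; the assumption on
      \<open>Lhat\<close>, which is conditional on existence and on \<open>n \<ge> 1\<close>, then
      applies to all large \<open>n\<close>.\<close>
    have "eventually (\<lambda>n. \<forall>J. 0 < empirical_frequency n (\<lambda>i. Z i \<omega>) J) sequentially"
      using order_tendstoD(1)[OF *[rule_format] dpp_prob_pos[OF assms(2)]]
      by (intro eventually_all_finite)
    then have "eventually (\<lambda>n. is_arg_max (weighted_log_likelihood
        (empirical_frequency n (\<lambda>i. Z i \<omega>))) (\<lambda>K. K \<in> sym_pos_def) (Lhat n \<omega>)) sequentially"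
      using eventually_ge_at_top[of 1]
    proof eventually_elim
      case (elim n)
      then have "\<exists>L. is_MLE n (\<lambda>i. Z i \<omega>) L"
        unfolding is_MLE_def log_likelihood_eq_weighted
        by (intro weighted_log_likelihood_has_maximizer) auto
      then show ?case
        using assms(5)[OF elim(2) \<omega>] by (simp add: is_MLE_def log_likelihood_eq_weighted)
    qed
    then show "(\<lambda>n. dpp_loss (Lhat n \<omega>) Lstar) \<longlonglongrightarrow> 0"
      using * by (intro dpp_loss_argmax_tendsto_0[OF assms(2)]) auto
  qed
qed

end
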